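(* The Last-leftmost or First-rightmost Mechanism (LoF-M) is strategyproof and has an approximation ratio of $17/8$ for minimizing the maximum cost when locations are private and group memberships are public; that is, it is strategyproof in that setting and for every profile $\mathbf r$ its output $y$ satisfies $\mathrm{MC}(y,\mathbf r)\le \frac{17}{8}\min_{z\in[0,1]}\mathrm{MC}(z,\mathbf r)$.
   Context: Setting. $N=\{1,\dots,n\}$ is a set of agents, $I=[0,1]$, $[m]=\{1,\dots,m\}$ indexes groups. Agent $i$ has a profile $r_i=(x_i,g_i)$ with location $x_i\in I$ and group $g_i\in[m]$; $\mathbf r=(r_1,\dots,r_n)$. $G_j=\{i\in N: g_i=j\}$. $d(a,b)=|a-b|$. Each group $j$ has a known externality factor $\alpha_j\ge 0$. If the facility is at $y\in I$, the cost of agent $i$ is $$c_i(y,\mathbf r)=d(y,x_i)+\alpha_{g_i}\sum_{k\in G_{g_i}\setminus\{i\}}(1-d(y,x_k)).$$ Standing assumption: $\alpha_j\le 1/(|G_j|-1)$ for each group $j$ (void if $|G_j|\le 1$). Maximum cost: $\mathrm{MC}(y,\mathbf r)=\max_{i\in N}c_i(y,\mathbf r)$. A (deterministic) mechanism $f$ maps a profile to a facility location in $I$. Strategyproof when locations are private and group memberships are public: for every true profile $\mathbf r$, every reported profile $\mathbf r'$ with the same group memberships ($g'_k=g_k$ for all $k$) and every agent $i$, $c_i(f(r_i,\mathbf r'_{-i}),\mathbf r)\le c_i(f(\mathbf r'),\mathbf r)$, where $\mathbf r'_{-i}$ are the reports of all agents other than $i$. LoF-M: for each (nonempty) group $j$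 let $x^j_{lm}=\min_{i\in G_j}x_i$ and $x^j_{rm}=\max_{i\in G_j}x_i$. Put $x^*_{lm}=\max_{j}x^j_{lm}$ and $x^*_{rm}=\min_j x^j_{rm}$, the max and min being over nonempty groups $j\in[m]$. Output $y=\min\{x^*_{lm},x^*_{rm}\}$. *)

theory Defs
  imports "HOL-Analysis.Analysis"
begin

text \<open>Agents are \<open>1, \<dots>, n\<close>; a profile assigns to each agent a location in the unit
  interval and a group in \<open>{1..m}\<close>.\<close>

type_synonym profile = "nat \<Rightarrow> real \<times> nat"

abbreviation loc :: "profile \<Rightarrow> nat \<Rightarrow> real" where
  "loc r i \<equiv> fst (r i)"

abbreviation grp :: "profile \<Rightarrow> nat \<Rightarrow> nat" where
  "grp r i \<equiv> snd (r i)"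

definition profiles :: "nat \<Rightarrow> nat \<Rightarrow> profile set" where
  "profiles n m = {1..n} \<rightarrow>\<^sub>E {0..1} \<times> {1..m}"

definition group_members :: "nat \<Rightarrow> profile \<Rightarrow> nat \<Rightarrow> nat set" where
  "group_members n r j = {i \<in> {1..n}. grp r i = j}"

text \<open>The bound on the externality factors constrains only groups with at least two members;
  the guard is needed because \<open>1 / 0 = 0\<close>.\<close>

definition admissible_profiles :: "nat \<Rightarrow> nat \<Rightarrow> (nat \<Rightarrow> real) \<Rightarrow> profile set" where
  "admissible_profiles n m \<alpha> =
     {r \<in> profiles n m. \<forall>j\<in>{1..m}. 2 \<le> card (group_members n r j) \<longrightarrow>
        \<alpha> j \<le> 1 / (real (card (group_members n r j)) - 1)}"

definition cost :: "nat \<Rightarrow> (nat \<Rightarrow> real) \<Rightarrow> real \<Rightarrow> profile \<Rightarrow> nat \<Rightarrow> real" where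
  "cost n \<alpha> y r i = \<bar>y - loc r i\<bar> +
     \<alpha> (grp r i) * (\<Sum>k \<in> group_members n r (grp r i) - {i}. 1 - \<bar>y - loc r k\<bar>)"

definition max_cost :: "nat \<Rightarrow> (nat \<Rightarrow> real) \<Rightarrow> real \<Rightarrow> profile \<Rightarrow> real" where
  "max_cost n \<alpha> y r = Max ((\<lambda>i. cost n \<alpha> y r i) ` {1..n})"

definition opt_max_cost :: "nat \<Rightarrow> (nat \<Rightarrow> real) \<Rightarrow> profile \<Rightarrow> real" where
  "opt_max_cost n \<alpha> r = (INF z\<in>{0..1}. max_cost n \<alpha> z r)"

definition mechanism :: "nat \<Rightarrow> nat \<Rightarrow> (profile \<Rightarrow> real) \<Rightarrow> bool" where
  "mechanism n m f \<longleftrightarrow> f \<in> profiles n m \<rightarrow> {0..1}"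

text \<open>Locations are private and group memberships are public: \<open>r\<close> is the true profile, and the
  reports \<open>r'\<close> may differ from it in the locations only. Costs are evaluated at the true profile.\<close>

definition strategyproof ::
    "nat \<Rightarrow> nat \<Rightarrow> (nat \<Rightarrow> real) \<Rightarrow> (profile \<Rightarrow> real) \<Rightarrow> bool" where
  "strategyproof n m \<alpha> f \<longleftrightarrow>
     (\<forall>r \<in> admissible_profiles n m \<alpha>. \<forall>r' \<in> profiles n m.
        (\<forall>k\<in>{1..n}. grp r' k = grp r k) \<longrightarrow>
        (\<forall>i\<in>{1..n}. cost n \<alpha> (f (r'(i := r i))) r i \<le> cost n \<alpha> (f r') r i))"

definition max_cost_approximation ::
    "nat \<Rightarrow> nat \<Rightarrow> (nat \<Rightarrow> real) \<Rightarrow> real \<Rightarrow> (profile \<Rightarrow> real) \<Rightarrow> bool" where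
  "max_cost_approximation n m \<alpha> \<rho> f \<longleftrightarrow>
     (\<forall>r \<in> admissible_profiles n m \<alpha>. max_cost n \<alpha> (f r) r \<le> \<rho> * opt_max_cost n \<alpha> r)"

definition nonempty_groups :: "nat \<Rightarrow> nat \<Rightarrow> profile \<Rightarrow> nat set" where
  "nonempty_groups n m r = {j \<in> {1..m}. group_members n r j \<noteq> {}}"

definition leftmost :: "nat \<Rightarrow> profile \<Rightarrow> nat \<Rightarrow> real" where
  "leftmost n r j = Min (loc r ` group_members n r j)"

definition rightmost :: "nat \<Rightarrow> profile \<Rightarrow> nat \<Rightarrow> real" where
  "rightmost n r j = Max (loc r ` group_members n r j)"

definition LoF_M :: "nat \<Rightarrow> nat \<Rightarrow> profile \<Rightarrow> real" where
  "LoF_M n m r = min (Max (leftmost n r ` nonempty_groups n m r))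
                     (Min (rightmost n r ` nonempty_groups n m r))"

lemma continuous_on_max_cost:
  assumes "n \<ge> 1"
  shows "continuous_on A (\<lambda>z. max_cost n \<alpha> z r)"
proof -
  have "continuous_on A (\<lambda>z. Max ((\<lambda>i. cost n \<alpha> z r i) ` S))"
    if "finite S" "S \<noteq> {}" for S
    using that
  proof (induction S rule: finite_ne_induct)
    case (singleton i)
    then show ?case by (auto simp: cost_def intro!: continuous_intros)
  next
    case (insert i S)
    have "continuous_on A (\<lambda>z. cost n \<alpha> z r i)"
      by (auto simp: cost_def intro!: continuous_intros)
    then show ?case using insert by (auto intro!: continuous_on_max)
  qed
  then show ?thesis using assms by (simp add: max_cost_def)
qed

text \<open>The infimum defining the optimal maximum cost is a minimum.\<close>

lemma opt_max_cost_attained: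
  assumes "n \<ge> 1"
  shows "\<exists>z\<in>{0..1}. opt_max_cost n \<alpha> r = max_cost n \<alpha> z r \<and>
           (\<forall>w\<in>{0..1}. max_cost n \<alpha> z r \<le> max_cost n \<alpha> w r)"
proof -
  obtain z where z: "z \<in> {0..1}" "\<forall>w\<in>{0..1}. max_cost n \<alpha> z r \<le> max_cost n \<alpha> w r"
    using continuous_attains_inf[of "{0..1::real}" "\<lambda>z. max_cost n \<alpha> z r"]
      continuous_on_max_cost[OF assms] by auto
  then have "opt_max_cost n \<alpha> r = max_cost n \<alpha> z r"
    unfolding opt_max_cost_def by (intro cInf_eq_minimum) auto
  with z show ?thesis by blast
qed

end

theory Submission
  imports Defs
begin

text \<open>Strategyproofness: since \<open>\<alpha>\<^sub>j (|G\<^sub>j| - 1) \<le> 1\<close>, an agent's cost weakly decreases when the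
  facility moves towards her, and LoF-M is a monotone threshold function of the locations, so
  reporting truthfully puts the facility between her location and the output of any misreport.

  Approximation: the output \<open>y\<close> is the location of some agent, so an optimal \<open>z\<close> satisfies
  \<open>L = |y - z| \<le> V\<close> for the optimal value \<open>V\<close>. For an agent \<open>i\<close> let \<open>d = |z - x\<^sub>i|\<close>, let \<open>D\<close> be
  the average distance from \<open>z\<close> to the other members of her group, and \<open>a = \<alpha>\<^sub>j (|G\<^sub>j| - 1)\<close>. Then
  \<open>V \<ge> d + a (1 - D)\<close>, and the cost of a group member at distance at least \<open>D\<close> gives
  \<open>V \<ge> D + a (1 - max d D)\<close>. The worst case has \<open>L + d\<close> as the distance from \<open>y\<close>, and linear
  programming duality then bounds the cost by \<open>(2 + a - 2 a\<^sup>2) V\<close> for \<open>a \<le> 1/2\<close> and by \<open>2 V\<close> for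
  \<open>a \<ge> 1/2\<close>; the maximum \<open>17/8\<close> is reached at \<open>a = 1/4\<close>.\<close>

subsection \<open>The bound for a single agent\<close>

lemma quadratic_factor_bound:
  fixes a V :: real
  assumes "0 \<le> V"
  shows "(2 + a - 2 * a\<^sup>2) * V \<le> 17 / 8 * V"
proof -
  have "17 / 8 - (2 + a - 2 * a\<^sup>2) = 2 * (a - 1 / 4)\<^sup>2"
    by (simp add: power2_eq_square algebra_simps)
  then have "2 + a - 2 * a\<^sup>2 \<le> 17 / 8"
    by (smt (verit) zero_le_power2)
  then show ?thesis using assms by (rule mult_right_mono)
qed

text \<open>The products in the following two proofs are the dual multipliers.\<close>

lemma ratio_bound_far:
  fixes a d D L V :: real
  assumes a: "0 \<le> a" "a \<le> 1" and nonneg: "0 \<le> d" "0 \<le> D" "0 \<le> L"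
    and VL: "L \<le> V" and Vd: "d + a * (1 - D) \<le> V" and VD: "D + a * (1 - d) \<le> V"
    and dL: "d + L \<le> 1"
  shows "d + L + a * (1 - \<bar>D - L\<bar>) \<le> 17 / 8 * V"
proof (cases "a \<le> 1 / 2")
  case True
  \<comment> \<open>The multiplier \<open>(1 + a) * (1 - 2 * a)\<close> of \<open>V - L\<close> is
    nonnegative only up to \<open>a = 1 / 2\<close>; this dictates the case split.\<close>
  have "0 \<le> (1 + a) * (1 - 2 * a)" using a True by (intro mult_nonneg_nonneg) auto
  then have "0 \<le> ((1 + a) * (1 - 2 * a)) * (V - L)" using VL by simp
  moreover have "0 \<le> (2 * a) * (V - (D + a * (1 - d)))"
    using a VD by (intro mult_nonneg_nonneg) auto
  moreover have "0 \<le> (2 * a\<^sup>2) * (1 - d - L)" using a dL by (intro mult_nonneg_nonneg) auto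
  moreover have "a * (1 - \<bar>D - L\<bar>) \<le> a * (1 - (L - D))" using a by (intro mult_left_mono) auto
  ultimately have "d + L + a * (1 - \<bar>D - L\<bar>) \<le> (2 + a - 2 * a\<^sup>2) * V"
    using Vd by (simp add: algebra_simps power2_eq_square)
  also have "\<dots> \<le> 17 / 8 * V" using quadratic_factor_bound VL nonneg by simp
  finally show ?thesis .
next
  case False
  \<comment> \<open>For larger \<open>a\<close>, the constraints \<open>Vd\<close> and
    \<open>VD\<close> each enter with weight 1.\<close>
  have "0 \<le> a * (1 - d - L)" using a dL by (intro mult_nonneg_nonneg) auto
  moreover have "0 \<le> (2 * a - 1) * (L - D)" if "D \<le> L"
    using that False by (intro mult_nonneg_nonneg) auto
  ultimately have "d + L + a * (1 - \<bar>D - L\<bar>) \<le> 2 * V"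
    using Vd VD by (cases "D \<le> L") (auto simp: algebra_simps abs_if)
  then show ?thesis using VL nonneg by simp
qed

lemma ratio_bound_near:
  fixes a D L V :: real
  assumes a: "0 \<le> a" "a \<le> 1"
    and VL: "L \<le> V" and VD: "D + a * (1 - D) \<le> V" and DL: "1 \<le> D + L" and "0 \<le> L"
  shows "1 + a * (1 - \<bar>D - L\<bar>) \<le> 17 / 8 * V"
proof -
  consider "L \<le> D" | "D \<le> L" "a \<le> 1 / 2" | "D \<le> L" "1 / 2 \<le> a" by linarith
  then show ?thesis
  proof cases
    case 1
    have "0 \<le> (1 - a) * (D + L - 1)" using a DL by (intro mult_nonneg_nonneg) auto
    then have "1 + a * (1 - \<bar>D - L\<bar>) \<le> 2 * V" using VD 1 by (simp add: algebra_simps)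
    then show ?thesis using VL \<open>0 \<le> L\<close> by simp
  next
    case 2
    have "0 \<le> (1 + a) * (1 - 2 * a)" using a 2 by (intro mult_nonneg_nonneg) auto
    then have "0 \<le> ((1 + a) * (1 - 2 * a)) * (V - L)" using VL by simp
    moreover have "0 \<le> (1 + 2 * a) * (V - (D + a * (1 - D)))"
      using a VD by (intro mult_nonneg_nonneg) auto
    moreover have "a\<^sup>2 \<le> (1 / 2)\<^sup>2" using a 2 by (intro power_mono) auto
    then have "0 \<le> (1 - 2 * a\<^sup>2) * (D + L - 1)"
      using DL by (intro mult_nonneg_nonneg) (auto simp: power2_eq_square)
    ultimately have "1 + a * (1 - \<bar>D - L\<bar>) \<le> (2 + a - 2 * a\<^sup>2) * V"
      using 2 by (simp add: algebra_simps power2_eq_square)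
    also have "\<dots> \<le> 17 / 8 * V" using quadratic_factor_bound VL \<open>0 \<le> L\<close> by simp
    finally show ?thesis .
  next
    case 3
    have "1 + a * (1 - \<bar>D - L\<bar>) \<le> 2 * V"
    \<comment> \<open>Twice the left side of \<open>VD\<close> exceeds the target by at least
      \<open>a * (D + L - 1) + (1 - 2 * D) * (2 * a - 1)\<close>, whose second product turns
      negative beyond \<open>D = 1 / 2\<close>. There the target is at most \<open>1 + a\<close>,
      and \<open>1 + a\<close> is at most twice the left side of \<open>VD\<close>.\<close>
    proof (cases "D \<le> 1 / 2")
      case True
      have "0 \<le> a * (D + L - 1)" "0 \<le> (1 - 2 * D) * (2 * a - 1)"
        using a DL True 3 by (auto intro!: mult_nonneg_nonneg)
      then show ?thesis using VD 3 by (simp add: algebra_simps)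
    next
      case False
      have "a * D \<le> a * L" using a 3 by (intro mult_left_mono) auto
      moreover have "0 \<le> (2 * D - 1) * (1 - a)"
        using a False by (intro mult_nonneg_nonneg) auto
      then have "1 + 2 * (a * D) \<le> a + 2 * D" by (simp add: algebra_simps)
      moreover have "D + a - a * D \<le> V" using VD by (simp add: algebra_simps)
      moreover have "a * (1 - \<bar>D - L\<bar>) = a - a * L + a * D" using 3 by (simp add: algebra_simps)
      ultimately show ?thesis by linarith
    qed
    then show ?thesis using VL \<open>0 \<le> L\<close> by simp
  qed
qed

text \<open>If \<open>d\<close> is below \<open>D\<close>, it can be raised to \<open>D\<close>: the
  constraint \<open>Vd\<close> then coincides with \<open>VD\<close>, and the left side only grows.
  This needs \<open>D + L \<le> 1\<close>; otherwise \<open>d + L\<close> is replaced by its cap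
  1.\<close>

lemma ratio_bound:
  fixes a d D L V :: real
  assumes a: "0 \<le> a" "a \<le> 1" and nonneg: "0 \<le> d" "0 \<le> D" "0 \<le> L"
    and VL: "L \<le> V" and Vd: "d + a * (1 - D) \<le> V" and VD: "D + a * (1 - max d D) \<le> V"
    and dL: "d + L \<le> 1"
  shows "d + L + a * (1 - \<bar>D - L\<bar>) \<le> 17 / 8 * V"
proof -
  consider "D \<le> d" | "d \<le> D" "D + L \<le> 1" | "d \<le> D" "1 \<le> D + L" by linarith
  then show ?thesis
  proof cases
    case 1
    then show ?thesis using ratio_bound_far[of a d D L V] assms by (simp add: max_def)
  next
    case 2
    then show ?thesis using ratio_bound_far[of a D D L V] assms by (simp add: max_def)
  next
    case 3
    then show ?thesis using ratio_bound_near[of a L V D] assms by (simp add: max_def)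
  qed
qed

text \<open>Here \<open>x\<close> is the agent's location and \<open>D'\<close> the average distance from \<open>y\<close> to the others.\<close>

lemma ratio_bound_positions:
  fixes a x y z D D' V :: real
  assumes a: "0 \<le> a" "a \<le> 1" and "0 \<le> D" and xy: "\<bar>x - y\<bar> \<le> 1"
    and D': "\<bar>D - \<bar>y - z\<bar>\<bar> \<le> D'"
    and VL: "\<bar>y - z\<bar> \<le> V" and Vd: "\<bar>z - x\<bar> + a * (1 - D) \<le> V"
    and VD: "D + a * (1 - max \<bar>z - x\<bar> D) \<le> V"
  shows "\<bar>y - x\<bar> + a * (1 - D') \<le> 17 / 8 * V"
proof -
  define d L where "d = \<bar>z - x\<bar>" and "L = \<bar>y - z\<bar>"
  have nonneg: "0 \<le> d" "0 \<le> L" by (auto simp: d_def L_def)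
  have V0: "0 \<le> V" using VL by linarith
  have DD: "a * (1 - D') \<le> a * (1 - \<bar>D - L\<bar>)"
    using D' a by (intro mult_left_mono) (auto simp: L_def)
  \<comment> \<open>The cases say which of \<open>z\<close>, \<open>y\<close>, \<open>x\<close> lies
    between the other two. Only \<open>z\<close> in the middle calls for the full ratio; the other
    orders give \<open>V\<close> and \<open>2 * V\<close>.\<close>
  consider "\<bar>y - x\<bar> = d + L" | "\<bar>y - x\<bar> = d - L" | "\<bar>y - x\<bar> = L - d"
    by (force simp: d_def L_def abs_if split: if_splits)
  then show ?thesis
  proof cases
    case 1
    then have "d + L + a * (1 - \<bar>D - L\<bar>) \<le> 17 / 8 * V"
      using assms nonneg
      by (intro ratio_bound) (auto simp: d_def L_def abs_minus_commute)
    then show ?thesis using 1 DD by linarith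
  next
    case 2
    have "a * (1 - \<bar>D - L\<bar>) \<le> a * (1 - D + L)" using a by (intro mult_left_mono) auto
    also have "\<dots> \<le> a * (1 - D) + L"
      using mult_right_mono[OF a(2) nonneg(2)] by (simp add: algebra_simps)
    finally show ?thesis using 2 DD Vd V0 unfolding d_def[symmetric] by linarith
  next
    case 3
    have aD: "a * (1 - \<bar>D - L\<bar>) \<le> a" using a by (intro mult_left_le) auto
    \<comment> \<open>Both branches amount to \<open>a \<le> V\<close>: the constraint
      \<open>Vd\<close> yields it when \<open>a * D \<le> d\<close>, and \<open>VD\<close> yields it
      when \<open>d < D\<close>.\<close>
    have "L - d + a * (1 - \<bar>D - L\<bar>) \<le> 2 * V"
    proof (cases "D \<le> d")
      case True
      have "a * D \<le> d" using True a nonneg \<open>0 \<le> D\<close> mult_right_mono[OF a(2) \<open>0 \<le> D\<close>] by linarith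
      then show ?thesis using aD VL Vd nonneg unfolding d_def[symmetric] L_def[symmetric]
        by (simp add: algebra_simps)
    next
      case False
      then have "D + a - a * D \<le> V"
        using VD by (simp add: d_def[symmetric] algebra_simps max_def)
      moreover have "a * D \<le> D" using a \<open>0 \<le> D\<close> by (simp add: mult_left_le_one_le)
      ultimately show ?thesis using aD VL nonneg unfolding L_def[symmetric] by linarith
    qed
    then show ?thesis using 3 DD V0 by linarith
  qed
qed

subsection \<open>Costs\<close>

lemma finite_group_members [simp]: "finite (group_members n r j)"
  by (simp add: group_members_def)

lemma group_members_cong:
  assumes "\<And>k. k \<in> {1..n} \<Longrightarrow> grp r k = grp r' k"
  shows "group_members n r = group_members n r'"
  using assms by (auto simp: group_members_def fun_eq_iff)

lemma profiles_loc: "r \<in> profiles n m \<Longrightarrow> i \<in> {1..n} \<Longrightarrow> loc r i \<in> {0..1}"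
  by (fastforce simp: profiles_def PiE_iff mem_Times_iff)

lemma profiles_grp: "r \<in> profiles n m \<Longrightarrow> i \<in> {1..n} \<Longrightarrow> grp r i \<in> {1..m}"
  by (fastforce simp: profiles_def PiE_iff mem_Times_iff)

lemma admissible_externality_le_1:
  assumes r: "r \<in> admissible_profiles n m \<alpha>" and i: "i \<in> {1..n}"
  shows "\<alpha> (grp r i) * real (card (group_members n r (grp r i) - {i})) \<le> 1"
proof -
  let ?G = "group_members n r (grp r i)"
  have iG: "i \<in> ?G" using i by (simp add: group_members_def)
  then have card: "card ?G = Suc (card (?G - {i}))"
    by (metis card_Suc_Diff1 finite_group_members)
  show ?thesis
  proof (cases "card (?G - {i}) = 0")
    \<comment> \<open>In a singleton group the product is 0 for every value of
      \<open>\<alpha>\<close>; admissibility bounds \<open>\<alpha>\<close> only from two members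
      on.\<close>
    case True
    then show ?thesis by (simp only: of_nat_0)
  next
    case False
    then have "2 \<le> card ?G" using card by linarith
    then have "\<alpha> (grp r i) \<le> 1 / (real (card ?G) - 1)"
      using r profiles_grp[of r n m i] i unfolding admissible_profiles_def by blast
    then show ?thesis using False card by (simp add: field_simps)
  qed
qed

lemma distance_le_cost:
  assumes r: "r \<in> profiles n m" and i: "i \<in> {1..n}" and \<alpha>: "0 \<le> \<alpha> (grp r i)"
    and z: "z \<in> {0..1}"
  shows "\<bar>z - loc r i\<bar> \<le> cost n \<alpha> z r i"
proof -
  have "0 \<le> 1 - \<bar>z - loc r k\<bar>" if "k \<in> group_members n r j" for j k
    using profiles_loc[OF r, of k] that z by (auto simp: group_members_def abs_if)
  then show ?thesis using \<alpha> unfolding cost_def by (auto intro!: mult_nonneg_nonneg sum_nonneg)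
qed

lemma cost_le_max_cost: "i \<in> {1..n} \<Longrightarrow> cost n \<alpha> z r i \<le> max_cost n \<alpha> z r"
  by (simp add: max_cost_def)

text \<open>A move by \<open>\<bar>y' - y\<bar>\<close> straight towards the agent saves exactly
  that much distance. Each other member's term rises by at most the same amount, so the externality
  rises by at most \<open>\<alpha>\<close> times the number of other members times the move, which
  is no more than the saving.\<close>

lemma cost_towards_agent:
  assumes r: "r \<in> admissible_profiles n m \<alpha>" and i: "i \<in> {1..n}" and \<alpha>: "0 \<le> \<alpha> (grp r i)"
    and between: "\<bar>y' - loc r i\<bar> = \<bar>y' - y\<bar> + \<bar>y - loc r i\<bar>"
  shows "cost n \<alpha> y r i \<le> cost n \<alpha> y' r i"
proof -
  let ?H = "group_members n r (grp r i) - {i}"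
  have "(\<Sum>k\<in>?H. 1 - \<bar>y - loc r k\<bar>) \<le> (\<Sum>k\<in>?H. (1 - \<bar>y' - loc r k\<bar>) + \<bar>y' - y\<bar>)"
    by (intro sum_mono) linarith
  also have "\<dots> = (\<Sum>k\<in>?H. 1 - \<bar>y' - loc r k\<bar>) + card ?H * \<bar>y' - y\<bar>"
    by (simp only: sum.distrib sum_constant)
  finally have "\<alpha> (grp r i) * (\<Sum>k\<in>?H. 1 - \<bar>y - loc r k\<bar>) \<le>
      \<alpha> (grp r i) * ((\<Sum>k\<in>?H. 1 - \<bar>y' - loc r k\<bar>) + card ?H * \<bar>y' - y\<bar>)"
    using \<alpha> by (rule mult_left_mono)
  also have "\<dots> = \<alpha> (grp r i) * (\<Sum>k\<in>?H. 1 - \<bar>y' - loc r k\<bar>) +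
      \<alpha> (grp r i) * real (card ?H) * \<bar>y' - y\<bar>"
    by (simp only: distrib_left mult.assoc)
  also have "\<alpha> (grp r i) * real (card ?H) * \<bar>y' - y\<bar> \<le> \<bar>y' - y\<bar>"
    using mult_right_mono[OF admissible_externality_le_1[OF r i], of "\<bar>y' - y\<bar>"] by simp
  finally show ?thesis using between unfolding cost_def by linarith
qed

lemma exists_ge_average:
  fixes f :: "'a \<Rightarrow> real"
  assumes "finite A" "A \<noteq> {}"
  shows "\<exists>k\<in>A. sum f A / card A \<le> f k"
proof (rule ccontr)
  assume "\<not> ?thesis"
  then have "sum f A < of_nat (card A) * (sum f A / card A)"
    using assms by (intro sum_bounded_above_strict) (auto simp: not_le card_gt_0_iff)
  then show False using assms by simp
qed

text \<open>Placing the facility at an agent \<open>j\<close> is what makes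
  \<open>\<bar>y - z\<bar>\<close> at most \<open>V\<close>: it is the distance part of the cost of
  \<open>j\<close> at \<open>z\<close>. The remaining work is to derive the constraints of
  \<open>ratio_bound_positions\<close> with \<open>a = b * c\<close> and average distance
  \<open>D z\<close>.\<close>

lemma cost_ratio:
  assumes r: "r \<in> admissible_profiles n m \<alpha>" and i: "i \<in> {1..n}" and j: "j \<in> {1..n}"
    and \<alpha>: "\<And>j. j \<in> {1..m} \<Longrightarrow> 0 \<le> \<alpha> j" and z: "z \<in> {0..1}"
  shows "cost n \<alpha> (loc r j) r i \<le> 17 / 8 * max_cost n \<alpha> z r"
proof -
  define H where "H = group_members n r (grp r i) - {i}"
  define y V c b where "y = loc r j" and "V = max_cost n \<alpha> z r"
    and "c = real (card H)" and "b = \<alpha> (grp r i)"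
  define dist_sum where "dist_sum w = (\<Sum>k\<in>H. \<bar>w - loc r k\<bar>)" for w
  define D where "D w = dist_sum w / c" for w
  have rp: "r \<in> profiles n m" using r by (simp add: admissible_profiles_def)
  have b: "0 \<le> b" using \<alpha> profiles_grp[OF rp i] by (simp add: b_def)
  have bc: "b * c \<le> 1"
    using admissible_externality_le_1[OF r i] by (simp add: b_def c_def H_def)
  have fin: "finite H" by (simp add: H_def)
  have costH: "cost n \<alpha> w r i = \<bar>w - loc r i\<bar> + b * (c - dist_sum w)" for w
    by (simp add: cost_def H_def b_def c_def dist_sum_def sum_subtractf)
  have "\<bar>z - loc r j\<bar> \<le> V"
    using distance_le_cost[OF rp j _ z] \<alpha> profiles_grp[OF rp j]
      cost_le_max_cost[OF j, of \<alpha> z r] unfolding V_def by force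
  then have VL: "\<bar>y - z\<bar> \<le> V" by (simp add: y_def abs_minus_commute)
  have Vi: "cost n \<alpha> z r i \<le> V" using cost_le_max_cost[OF i] by (simp add: V_def)
  have main: "\<bar>y - loc r i\<bar> + b * c * (1 - D y) \<le> 17 / 8 * V" if H: "H \<noteq> {}"
  proof (rule ratio_bound_positions)
    have c: "0 < c" using H fin by (simp add: c_def card_gt_0_iff)
    show "0 \<le> b * c" using b c by simp
    show "b * c \<le> 1" by (rule bc)
    show "0 \<le> D z" using c by (simp add: D_def dist_sum_def sum_nonneg)
    show "\<bar>loc r i - y\<bar> \<le> 1"
      using profiles_loc[OF rp i] profiles_loc[OF rp j] by (auto simp: y_def abs_if)
    \<comment> \<open>Two triangle inequalities, summed over \<open>H\<close> and divided by
      \<open>c\<close>, bound the new average \<open>D y\<close> from below.\<close>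
    have "dist_sum z \<le> (\<Sum>k\<in>H. \<bar>y - loc r k\<bar> + \<bar>y - z\<bar>)"
         "(\<Sum>k\<in>H. \<bar>y - z\<bar>) \<le> (\<Sum>k\<in>H. \<bar>y - loc r k\<bar> + \<bar>z - loc r k\<bar>)"
      unfolding dist_sum_def by (intro sum_mono, linarith)+
    then have "dist_sum z \<le> dist_sum y + c * \<bar>y - z\<bar>" "c * \<bar>y - z\<bar> \<le> dist_sum y + dist_sum z"
      by (simp_all add: sum.distrib dist_sum_def c_def)
    then have "D z \<le> D y + \<bar>y - z\<bar>" "\<bar>y - z\<bar> \<le> D y + D z"
      using c by (simp_all add: D_def field_simps)
    then show "\<bar>D z - \<bar>y - z\<bar>\<bar> \<le> D y" by linarith
    show "\<bar>y - z\<bar> \<le> V" by (rule VL)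
    have "b * c * (1 - D z) = b * (c - dist_sum z)" using c by (simp add: D_def field_simps)
    then show "\<bar>z - loc r i\<bar> + b * c * (1 - D z) \<le> V" using Vi costH[of z] by linarith
    \<comment> \<open>A member at least as far from \<open>z\<close> as the average supplies the
      second constraint through her own cost.\<close>
    obtain k where k: "k \<in> H" "D z \<le> \<bar>z - loc r k\<bar>"
      using exists_ge_average[OF fin H] unfolding D_def dist_sum_def c_def by blast
    have kn: "k \<in> {1..n}" and gk: "grp r k = grp r i" and ki: "k \<noteq> i"
      using k by (auto simp: H_def group_members_def)
    \<comment> \<open>From the viewpoint of \<open>k\<close>, agent \<open>i\<close> takes the place
      of \<open>k\<close> among the others.\<close>
    have "group_members n r (grp r i) - {k} = insert i (H - {k})"
      using i ki by (auto simp: H_def group_members_def)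
    moreover have "(\<Sum>l\<in>H - {k}. 1 - \<bar>z - loc r l\<bar>) = (c - dist_sum z) - (1 - \<bar>z - loc r k\<bar>)"
      using sum_diff1[OF fin, of "\<lambda>l. 1 - \<bar>z - loc r l\<bar>" k] k(1)
      by (simp add: sum_subtractf c_def dist_sum_def)
    moreover have "i \<notin> H" by (simp add: H_def)
    ultimately have ck: "cost n \<alpha> z r k = \<bar>z - loc r k\<bar> +
        b * ((1 - \<bar>z - loc r i\<bar>) + ((c - dist_sum z) - (1 - \<bar>z - loc r k\<bar>)))"
      using fin gk by (simp add: cost_def b_def)
    \<comment> \<open>The externality sum of \<open>k\<close> is at least
      \<open>c * (1 - M)\<close>: agent \<open>i\<close> contributes at least \<open>1 - M\<close>,
      and the other \<open>c - 1\<close> members have average distance at most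
      \<open>D z \<le> M\<close>, because \<open>k\<close> is no closer than average.\<close>
    define M where "M = max \<bar>z - loc r i\<bar> (D z)"
    have c1: "1 \<le> c" using c by (simp add: c_def)
    have "(c - 1) * (1 - M) \<le> (c - 1) * (1 - D z)"
      using c1 by (intro mult_left_mono) (auto simp: M_def)
    then have "c * (1 - M) \<le> (1 - M) + (c - 1) * (1 - D z)" by (simp add: algebra_simps)
    also have "(c - 1) * (1 - D z) = (c - dist_sum z) - (1 - D z)"
      using c by (simp add: D_def field_simps)
    also have "(1 - M) + \<dots> \<le>
        (1 - \<bar>z - loc r i\<bar>) + ((c - dist_sum z) - (1 - \<bar>z - loc r k\<bar>))"
      using k(2) by (auto simp: M_def)
    finally have "b * (c * (1 - M)) \<le>
        b * ((1 - \<bar>z - loc r i\<bar>) + ((c - dist_sum z) - (1 - \<bar>z - loc r k\<bar>)))"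
      using b by (rule mult_left_mono)
    then show "D z + b * c * (1 - max \<bar>z - loc r i\<bar> (D z)) \<le> V"
      using ck k(2) cost_le_max_cost[OF kn, of \<alpha> z r]
      unfolding M_def[symmetric] V_def mult.assoc by linarith
  qed
  show ?thesis
  proof (cases "H = {}")
    \<comment> \<open>Without other members the average is meaningless; the cost is the plain
      distance, and the triangle inequality gives \<open>2 * V\<close>.\<close>
    case True
    then have "c = 0" "dist_sum w = 0" for w by (simp_all add: c_def dist_sum_def)
    then have "cost n \<alpha> z r i = \<bar>z - loc r i\<bar>" "cost n \<alpha> y r i = \<bar>y - loc r i\<bar>"
      by (simp_all add: costH)
    then show ?thesis using Vi VL unfolding V_def[symmetric] y_def[symmetric] by linarith
  next
    case False
    then have "c \<noteq> 0" using fin by (simp add: c_def)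
    then have "b * c * (1 - D y) = b * (c - dist_sum y)" by (simp add: D_def field_simps)
    then show ?thesis using main[OF False] costH[of y]
      unfolding V_def[symmetric] y_def[symmetric] by linarith
  qed
qed

subsection \<open>The mechanism\<close>

lemma finite_nonempty_groups [simp]: "finite (nonempty_groups n m r)"
  by (simp add: nonempty_groups_def)

lemma nonempty_groups_nonempty:
  assumes "n \<ge> 1" "r \<in> profiles n m"
  shows "nonempty_groups n m r \<noteq> {}"
proof -
  have "grp r 1 \<in> nonempty_groups n m r"
    using assms profiles_grp[OF assms(2), of 1]
    by (auto simp: nonempty_groups_def group_members_def)
  then show ?thesis by blast
qed

text \<open>Maxima turn into existential and minima into universal conditions. The point of this
  form is that it depends only on which agents lie at or right of \<open>t\<close>, and
  monotonically so.\<close>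

lemma LoF_M_ge_iff:
  assumes "n \<ge> 1" "r \<in> profiles n m"
  shows "t \<le> LoF_M n m r \<longleftrightarrow>
    (\<exists>j\<in>nonempty_groups n m r. \<forall>i\<in>group_members n r j. t \<le> loc r i) \<and>
    (\<forall>j\<in>nonempty_groups n m r. \<exists>i\<in>group_members n r j. t \<le> loc r i)"
proof -
  have ne: "group_members n r j \<noteq> {}" if "j \<in> nonempty_groups n m r" for j
    using that by (simp add: nonempty_groups_def)
  then have "t \<le> leftmost n r j \<longleftrightarrow> (\<forall>i\<in>group_members n r j. t \<le> loc r i)"
    "t \<le> rightmost n r j \<longleftrightarrow> (\<exists>i\<in>group_members n r j. t \<le> loc r i)"
    if "j \<in> nonempty_groups n m r" for j
    using that by (simp_all add: leftmost_def rightmost_def Max_ge_iff)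
  then show ?thesis
    using nonempty_groups_nonempty[OF assms] by (simp add: LoF_M_def Max_ge_iff)
qed

text \<open>All minima and maxima range over finite nonempty sets and are attained. This keeps the
  output in the unit interval and lets \<open>cost_ratio\<close> apply.\<close>

lemma LoF_M_is_loc:
  assumes "n \<ge> 1" "r \<in> profiles n m"
  shows "\<exists>i\<in>{1..n}. LoF_M n m r = loc r i"
proof -
  have "leftmost n r j \<in> loc r ` {1..n}" "rightmost n r j \<in> loc r ` {1..n}"
    if "j \<in> nonempty_groups n m r" for j
  proof -
    have "loc r ` group_members n r j \<noteq> {}" using that by (simp add: nonempty_groups_def)
    then have "leftmost n r j \<in> loc r ` group_members n r j"
      "rightmost n r j \<in> loc r ` group_members n r j"
      unfolding leftmost_def rightmost_def by (auto intro: Min_in Max_in simp del: image_is_empty)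
    then show "leftmost n r j \<in> loc r ` {1..n}" "rightmost n r j \<in> loc r ` {1..n}"
      by (auto simp: group_members_def)
  qed
  moreover have "Max (leftmost n r ` nonempty_groups n m r) \<in> leftmost n r ` nonempty_groups n m r"
    "Min (rightmost n r ` nonempty_groups n m r) \<in> rightmost n r ` nonempty_groups n m r"
    using nonempty_groups_nonempty[OF assms] by (auto intro: Max_in Min_in)
  ultimately have "LoF_M n m r \<in> loc r ` {1..n}"
    unfolding LoF_M_def min_def by (auto simp del: atLeastAtMost_iff)
  then show ?thesis by auto
qed

text \<open>Monotonicity is stated at a single threshold \<open>t\<close>, so that a deviating agent
  needs to be compared with \<open>t\<close> only.\<close>

lemma LoF_M_ge_mono:
  assumes n: "n \<ge> 1" and r: "r \<in> profiles n m" "r' \<in> profiles n m"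
    and grp: "\<And>k. k \<in> {1..n} \<Longrightarrow> grp r' k = grp r k"
    and loc: "\<And>k. k \<in> {1..n} \<Longrightarrow> t \<le> loc r k \<Longrightarrow> t \<le> loc r' k"
    and t: "t \<le> LoF_M n m r"
  shows "t \<le> LoF_M n m r'"
proof -
  have G: "group_members n r' = group_members n r" by (intro group_members_cong grp)
  then have NG: "nonempty_groups n m r' = nonempty_groups n m r" by (simp add: nonempty_groups_def)
  have loc': "t \<le> loc r' k" if "k \<in> group_members n r j" "t \<le> loc r k" for j k
    using that loc by (simp add: group_members_def)
  show ?thesis
    using t unfolding LoF_M_ge_iff[OF n r(1)] LoF_M_ge_iff[OF n r(2)] G NG
    by (meson loc')
qed

lemma mechanism_LoF_M:
  assumes "n \<ge> 1"
  shows "mechanism n m (LoF_M n m)"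
  unfolding mechanism_def using LoF_M_is_loc[OF assms] profiles_loc
  by (metis Pi_I)

text \<open>With \<open>r\<close> holding the true location of \<open>i\<close>, no misreport moves
  the output towards or past her: if the output is left of her, she already counts as right of every
  threshold up to her location, and dually on the other side.\<close>

lemma LoF_M_between:
  assumes n: "n \<ge> 1" and r: "r \<in> profiles n m" "r' \<in> profiles n m"
    and grp: "\<And>k. k \<in> {1..n} \<Longrightarrow> grp r' k = grp r k"
    and loc: "\<And>k. k \<noteq> i \<Longrightarrow> loc r' k = loc r k"
  shows "\<bar>LoF_M n m r' - loc r i\<bar> =
    \<bar>LoF_M n m r' - LoF_M n m r\<bar> + \<bar>LoF_M n m r - loc r i\<bar>"
proof -
  let ?y = "LoF_M n m r" and ?y' = "LoF_M n m r'"
  have "?y' \<le> ?y" if "?y < loc r i"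
  proof (rule ccontr)
    assume *: "\<not> ?y' \<le> ?y"
    \<comment> \<open>This threshold is reached under \<open>r'\<close> and does not exceed the true
      location, so the truthful report meets it too; yet it lies strictly above
      \<open>?y\<close>.\<close>
    define t where "t = min ?y' (loc r i)"
    have "t \<le> ?y"
    proof (rule LoF_M_ge_mono[OF n r(2,1)])
      show "grp r k = grp r' k" if "k \<in> {1..n}" for k using grp[OF that] by simp
      show "t \<le> loc r k" if "k \<in> {1..n}" "t \<le> loc r' k" for k
        using that loc[of k] by (cases "k = i") (auto simp: t_def)
    qed (simp add: t_def)
    then show False using * that by (simp add: t_def)
  qed
  \<comment> \<open>At the threshold \<open>?y\<close> agent \<open>i\<close> is not counted under
    \<open>r\<close>, so the monotonicity condition is vacuous for her.\<close>
  moreover have "?y \<le> ?y'" if "loc r i < ?y"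
  proof (rule LoF_M_ge_mono[OF n r grp])
    show "?y \<le> loc r' k" if "k \<in> {1..n}" "?y \<le> loc r k" for k
      using that loc[of k] \<open>loc r i < ?y\<close> by (cases "k = i") auto
  qed auto
  ultimately show ?thesis by linarith
qed

lemma strategyproof_LoF_M:
  assumes n: "n \<ge> 1" and \<alpha>: "\<And>j. j \<in> {1..m} \<Longrightarrow> 0 \<le> \<alpha> j"
  shows "strategyproof n m \<alpha> (LoF_M n m)"
  unfolding strategyproof_def
proof (intro ballI impI)
  fix r r' i
  assume r: "r \<in> admissible_profiles n m \<alpha>" and r': "r' \<in> profiles n m"
    and grp: "\<forall>k\<in>{1..n}. grp r' k = grp r k" and i: "i \<in> {1..n}"
  have rp: "r \<in> profiles n m" using r by (simp add: admissible_profiles_def)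
  \<comment> \<open>The profiles \<open>r'(i := r i)\<close> and \<open>r'\<close> take the roles of
    \<open>r\<close> and \<open>r'\<close> in \<open>LoF_M_between\<close>; the other agents'
    reports stay arbitrary.\<close>
  have "r'(i := r i) \<in> profiles n m"
    using r' rp i by (auto simp: profiles_def PiE_iff extensional_def)
  then have "\<bar>LoF_M n m r' - loc (r'(i := r i)) i\<bar> =
      \<bar>LoF_M n m r' - LoF_M n m (r'(i := r i))\<bar> +
      \<bar>LoF_M n m (r'(i := r i)) - loc (r'(i := r i)) i\<bar>"
    using grp by (intro LoF_M_between[OF n _ r']) (simp_all del: fun_upd_apply, simp_all)
  then show "cost n \<alpha> (LoF_M n m (r'(i := r i))) r i \<le> cost n \<alpha> (LoF_M n m r') r i"
    using \<alpha> profiles_grp[OF rp i] by (intro cost_towards_agent[OF r i]) auto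
qed

theorem theorem6:
  fixes n m :: nat and \<alpha> :: "nat \<Rightarrow> real"
  assumes "n \<ge> 1"
    and "\<And>j. j \<in> {1..m} \<Longrightarrow> \<alpha> j \<ge> 0"
  shows "mechanism n m (LoF_M n m) \<and>
         strategyproof n m \<alpha> (LoF_M n m) \<and>
         max_cost_approximation n m \<alpha> (17 / 8) (LoF_M n m)"
proof (intro conjI)
  show "mechanism n m (LoF_M n m)" using assms(1) by (rule mechanism_LoF_M)
  show "strategyproof n m \<alpha> (LoF_M n m)" using assms by (rule strategyproof_LoF_M)
  show "max_cost_approximation n m \<alpha> (17 / 8) (LoF_M n m)"
    unfolding max_cost_approximation_def
  proof
    fix r assume r: "r \<in> admissible_profiles n m \<alpha>"
    then have "r \<in> profiles n m" by (simp add: admissible_profiles_def)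
    then obtain j where j: "j \<in> {1..n}" "LoF_M n m r = loc r j"
      using LoF_M_is_loc[OF assms(1)] by blast
    obtain z where z: "z \<in> {0..1}" "opt_max_cost n \<alpha> r = max_cost n \<alpha> z r"
      using opt_max_cost_attained[OF assms(1)] by blast
    have "cost n \<alpha> (loc r j) r i \<le> 17 / 8 * max_cost n \<alpha> z r" if "i \<in> {1..n}" for i
      using r that j(1) assms(2) z(1) by (rule cost_ratio)
    then show "max_cost n \<alpha> (LoF_M n m r) r \<le> 17 / 8 * opt_max_cost n \<alpha> r"
      using assms(1) unfolding z(2) j(2) max_cost_def[of n \<alpha> "loc r j"]
      by (subst Max_le_iff) auto
  qed
qed

end
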